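(* Fix $L_1, L_2 \in \mathcal{S}^N(k)$ and $\Omega\in \mathcal{S}^+(n)$, and write $\Omega$ as $$\Omega= X\Gamma X^\top + Z\Delta Z^\top + X \Xi Z^\top + Z \Xi^\top X^\top$$ with $\Gamma\in \mathcal{S}^+(k)$, $\Delta\in\mathcal{S}^+(n-k)$ and $\Xi$ a $k\times (n-k)$ matrix. Consider the general ridge estimators $\hat\beta(\Omega,K_1)$ and $\hat\beta(I,K_2)$ with $K_1 =\epsilon L_1$, $K_2 =\epsilon L_2$, where $\epsilon$ is a positive constant satisfying $$\epsilon \max \{ \| (\Gamma - \Xi \Delta^{-1} \Xi^\top ) L_1 \| , \| (X^\top X)^{-1} L_2 \| \} < 1,$$ with $\|\cdot \|$ a matrix norm. Then, as $\epsilon \downarrow 0$, $$\mathrm{d}_1(\Omega,\epsilon L_1,\epsilon L_2) = \sigma^2 \Xi \Delta^{-1} \Xi^\top - \sigma^2 \left\{ \Xi \Delta^{-1} \Xi^\top L_2 (X^\top X)^{-1} + (X^\top X)^{-1} L_2 \Xi \Delta^{-1} \Xi^\top \right\} \epsilon + O(\epsilon^2)$$ and $$\mathrm{d}_2(\Omega,\epsilon L_1,\epsilon L_2) = \sigma^2 \Xi \Delta^{-1} \Xi^\top - \sigma^2 \left\{ (X^\top X)^{-1}L_2 \Gamma +\Gamma L_2 (X^\top X)^{-1} - 2(\Gamma - \Xi \Delta^{-1} \Xi^\top )L_1(\Gamma - \Xi \Delta^{-1} \Xi^\top) \right\} \epsilon + O(\epsilon^2).$$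
   Context: All matrices are real. $\mathcal{S}^+(m)$ and $\mathcal{S}^N(m)$ denote the sets of $m\times m$ symmetric positive definite and symmetric positive semidefinite matrices, respectively; $I$ is an identity matrix of appropriate size. $X$ is a fixed $n\times k$ matrix with $n>k$ and $\mathrm{rank}(X)=k$. $Z$ is a fixed $n\times(n-k)$ matrix with $X^\top Z=0$ and $\mathrm{rank}(Z)=n-k$. The random vector $y\in\mathbb{R}^n$ follows the general linear model $$y = X\beta+\varepsilon,\quad \mathsf{E}[\varepsilon]=0,\quad \mathsf{E}[\varepsilon\varepsilon^\top]=\sigma^2\Omega,$$ where $\beta\in\mathbb{R}^k$ and $\sigma^2>0$ are fixed (non-random, independent of $\epsilon$). Every $\Omega\in\mathcal{S}^+(n)$ can be expressed in the form $X\Gamma X^\top + Z\Delta Z^\top + X \Xi Z^\top + Z \Xi^\top X^\top$ with $\Gamma\in \mathcal{S}^+(k)$, $\Delta\in\mathcal{S}^+(n-k)$ and $\Xi$ a $k\times(n-k)$ matrix. For $\Psi\in\mathcal{S}^+(n)$ and $K\in\mathcal{S}^N(k)$, the general ridge estimator is $$\hat\beta(\Psi,K) = (X^\top \Psi^{-1}X + K)^{-1} X^\top \Psi^{-1}y ,$$ and its mean square error matrix is $$\mathrm{MMSE}(\hat\beta(\Psi,K)) = \mathsf{E}\left[(\hat\beta(\Psi,K)-\beta)(\hat\beta(\Psi,K)-\beta)^\top\right].$$ All expectations are taken under the model above (with dispersion matrix $\sigma^2\Omega$). For $K_1,K_2\in\mathcal{S}^N(k)$ define $$\mathrm{d}_1(\Omega,K_1,K_2)=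 \mathsf{E}\left[ (\hat\beta(I,K_2) - \hat\beta(\Omega,K_1)) (\hat\beta(I,K_2) - \hat\beta(\Omega,K_1))^\top \right],$$ $$\mathrm{d}_2(\Omega,K_1,K_2)= \mathrm{MMSE}(\hat\beta(I,K_2)) - \mathrm{MMSE}(\hat\beta(\Omega,K_1)).$$ *)

theory Defs
  imports
    "HOL-Analysis.Analysis"
    "HOL-Probability.Probability"
    "HOL-Library.Landau_Symbols"
begin

text \<open>
  A real matrix with \<open>m\<close> rows and \<open>n\<close> columns has type \<^typ>\<open>real ^ 'n ^ 'm\<close>.
\<close>

definition symmetric_matrix :: "real ^ 'n ^ 'n \<Rightarrow> bool" where
  "symmetric_matrix A \<longleftrightarrow> transpose A = A"

definition pos_def :: "real ^ 'n ^ 'n \<Rightarrow> bool" where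
  "pos_def A \<longleftrightarrow> symmetric_matrix A \<and> (\<forall>x. x \<noteq> 0 \<longrightarrow> x \<bullet> (A *v x) > 0)"

definition pos_semidef :: "real ^ 'n ^ 'n \<Rightarrow> bool" where
  "pos_semidef A \<longleftrightarrow> symmetric_matrix A \<and> (\<forall>x. x \<bullet> (A *v x) \<ge> 0)"

text \<open>
  Matrix norms are understood to be submultiplicative. The library norm on
  \<^typ>\<open>real ^ 'k ^ 'k\<close> (the Frobenius norm) is one instance.
\<close>

definition matrix_norm :: "(real ^ 'k ^ 'k \<Rightarrow> real) \<Rightarrow> bool" where
  "matrix_norm N \<longleftrightarrow>
     (\<forall>A. N A \<ge> 0) \<and>
     (\<forall>A. N A = 0 \<longleftrightarrow> A = 0) \<and>
     (\<forall>c A. N (c *\<^sub>R A) = \<bar>c\<bar> * N A) \<and>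
     (\<forall>A B. N (A + B) \<le> N A + N B) \<and>
     (\<forall>A B. N (A ** B) \<le> N A * N B)"

definition outer :: "real ^ 'n \<Rightarrow> real ^ 'n \<Rightarrow> real ^ 'n ^ 'n" where
  "outer x y = (\<chi> i j. x $ i * y $ j)"

text \<open>
  Expectations of random vectors and matrices are Bochner integrals, that is, they are
  taken entrywise. Integrability is assumed explicitly because the Bochner integral of a
  non-integrable function is \<open>0\<close>.
\<close>

locale general_linear_model = prob_space M
  for M :: "'w measure"
    and X :: "real ^ 'k ^ 'n"
    and \<beta> :: "real ^ 'k"
    and \<sigma> :: real
    and \<Omega> :: "real ^ 'n ^ 'n"
    and u :: "'w \<Rightarrow> real ^ 'n"
    and y :: "'w \<Rightarrow> real ^ 'n" +
  assumes model: "y = (\<lambda>\<omega>. X *v \<beta> + u \<omega>)"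
    and variance_pos: "\<sigma>\<^sup>2 > 0"
    and error_integrable: "integrable M u"
    and error_mean: "expectation u = 0"
    and error_outer_integrable: "integrable M (\<lambda>\<omega>. outer (u \<omega>) (u \<omega>))"
    and error_dispersion: "expectation (\<lambda>\<omega>. outer (u \<omega>) (u \<omega>)) = \<sigma>\<^sup>2 *\<^sub>R \<Omega>"

definition ridge :: "real ^ 'k ^ 'n \<Rightarrow> real ^ 'n ^ 'n \<Rightarrow> real ^ 'k ^ 'k \<Rightarrow> real ^ 'n \<Rightarrow> real ^ 'k" where
  "ridge X \<Psi> K y =
     (matrix_inv (transpose X ** matrix_inv \<Psi> ** X + K) ** transpose X ** matrix_inv \<Psi>) *v y"

definition mmse :: "'w measure \<Rightarrow> real ^ 'k \<Rightarrow> ('w \<Rightarrow> real ^ 'k) \<Rightarrow> real ^ 'k ^ 'k" where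
  "mmse M \<beta> b = (\<integral>\<omega>. outer (b \<omega> - \<beta>) (b \<omega> - \<beta>) \<partial>M)"

text \<open>
  The dependence on the model (its probability space, design matrix, coefficient vector
  and response) is explicit in \<open>d1\<close> and \<open>d2\<close>.
\<close>

definition d1 :: "'w measure \<Rightarrow> real ^ 'k ^ 'n \<Rightarrow> ('w \<Rightarrow> real ^ 'n) \<Rightarrow>
    real ^ 'n ^ 'n \<Rightarrow> real ^ 'k ^ 'k \<Rightarrow> real ^ 'k ^ 'k \<Rightarrow> real ^ 'k ^ 'k" where
  "d1 M X y \<Omega> K1 K2 =
     (\<integral>\<omega>. outer (ridge X (mat 1) K2 (y \<omega>) - ridge X \<Omega> K1 (y \<omega>))
               (ridge X (mat 1) K2 (y \<omega>) - ridge X \<Omega> K1 (y \<omega>)) \<partial>M)"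

definition d2 :: "'w measure \<Rightarrow> real ^ 'k ^ 'n \<Rightarrow> real ^ 'k \<Rightarrow> ('w \<Rightarrow> real ^ 'n) \<Rightarrow>
    real ^ 'n ^ 'n \<Rightarrow> real ^ 'k ^ 'k \<Rightarrow> real ^ 'k ^ 'k \<Rightarrow> real ^ 'k ^ 'k" where
  "d2 M X \<beta> y \<Omega> K1 K2 =
     mmse M \<beta> (\<lambda>\<omega>. ridge X (mat 1) K2 (y \<omega>)) - mmse M \<beta> (\<lambda>\<omega>. ridge X \<Omega> K1 (y \<omega>))"

text \<open>
  The constraint \<open>\<epsilon> * c < 1\<close> holds for all small \<open>\<epsilon> > 0\<close>, so the filter along which
  \<open>\<epsilon>\<close> tends to \<open>0\<close> within the admissible values is exactly \<^term>\<open>at_right (0::real)\<close>.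
\<close>

lemma at_within_admissible:
  "at (0::real) within {\<epsilon>. 0 < \<epsilon> \<and> \<epsilon> * c < 1} = at_right 0"
proof (rule at_within_nhd)
  show "open {\<epsilon>::real. \<epsilon> * c < 1}"
    by (intro open_Collect_less continuous_intros)
qed auto

end

theory Submission
  imports Defs
begin

text \<open>
  Both estimators are linear: \<open>A \<epsilon> *v y\<close> with \<open>A \<epsilon> = (X\<^sup>T X + \<epsilon> L2)\<^sup>-\<^sup>1 X\<^sup>T\<close> and \<open>B \<epsilon> *v y\<close> with
  \<open>B \<epsilon> = (X\<^sup>T \<Omega>\<^sup>-\<^sup>1 X + \<epsilon> L1)\<^sup>-\<^sup>1 X\<^sup>T \<Omega>\<^sup>-\<^sup>1\<close>. If \<open>D\<close> is a matrix and \<open>b\<close> a constant vector, then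
  \<open>E[(D u + b)(D u + b)\<^sup>T] = \<sigma>\<^sup>2 D \<Omega> D\<^sup>T + b b\<^sup>T\<close>, so \<open>d1\<close> and \<open>d2\<close> are made of dispersion terms
  (with \<open>D\<close> one of \<open>A - B\<close>, \<open>A\<close>, \<open>B\<close>) and bias terms. At \<open>\<epsilon> = 0\<close> both estimators are unbiased, that is
  \<open>A 0 ** X = B 0 ** X = I\<close>; hence every bias is \<open>O(\<epsilon>)\<close> and its outer square is
  absorbed by the error term.

  What remains is to expand \<open>D \<Omega> D\<^sup>T\<close> to first order. The relation \<open>expands f a b\<close>, meaning
  \<open>f \<epsilon> = a + \<epsilon> b + O(\<epsilon>\<^sup>2)\<close>, is preserved by linear and bilinear operations
  (\<open>expands_linear\<close>, \<open>expands_bilinear\<close>), and \<open>expands_matrix_inv\<close> gives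
  \<open>(S + \<epsilon> L)\<^sup>-\<^sup>1 = S\<^sup>-\<^sup>1 - \<epsilon> S\<^sup>-\<^sup>1 L S\<^sup>-\<^sup>1 + O(\<epsilon>\<^sup>2)\<close>.

  The coefficients become explicit because the best linear unbiased estimator \<open>B 0\<close> can be written
  without \<open>\<Omega>\<^sup>-\<^sup>1\<close>. With \<open>G = (X\<^sup>T X)\<^sup>-\<^sup>1\<close> and \<open>H = (Z\<^sup>T Z)\<^sup>-\<^sup>1\<close>, the orthogonality of \<open>X\<close> and \<open>Z\<close> shows
  that \<open>blue = G X\<^sup>T - \<Xi> \<Delta>\<^sup>-\<^sup>1 H Z\<^sup>T\<close> satisfies \<open>blue \<Omega> = (\<Gamma> - P) X\<^sup>T\<close> and \<open>blue X = I\<close>. Therefore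
  \<open>(\<Gamma> - P) X\<^sup>T \<Omega>\<^sup>-\<^sup>1 X = I\<close>, so \<open>X\<^sup>T \<Omega>\<^sup>-\<^sup>1 X\<close> has the inverse \<open>\<Gamma> - P\<close> and \<open>B 0 = blue\<close>. The
  products of \<open>blue\<close>, of \<open>G X\<^sup>T\<close> and of their difference with \<open>\<Omega>\<close> then collapse to the stated
  coefficients.
\<close>

section \<open>Matrix identities\<close>

lemma bounded_bilinear_matrix_mult:
  "bounded_bilinear ((**) :: real ^ 'b ^ 'a \<Rightarrow> real ^ 'c ^ 'b \<Rightarrow> real ^ 'c ^ 'a)"
  unfolding bilinear_conv_bounded_bilinear[symmetric] bilinear_def
  by (auto intro!: linearI simp: matrix_matrix_mult_def vec_eq_iff distrib_left distrib_right
      sum.distrib sum_distrib_left mult_ac)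

lemmas matrix_mult_bilinear =
  bounded_bilinear.add_left[OF bounded_bilinear_matrix_mult]
  bounded_bilinear.add_right[OF bounded_bilinear_matrix_mult]
  bounded_bilinear.diff_left[OF bounded_bilinear_matrix_mult]
  bounded_bilinear.diff_right[OF bounded_bilinear_matrix_mult]
  bounded_bilinear.minus_left[OF bounded_bilinear_matrix_mult]
  bounded_bilinear.minus_right[OF bounded_bilinear_matrix_mult]
  bounded_bilinear.scaleR_left[OF bounded_bilinear_matrix_mult]
  bounded_bilinear.scaleR_right[OF bounded_bilinear_matrix_mult]

lemma bounded_linear_transpose:
  "bounded_linear (transpose :: real ^ 'b ^ 'a \<Rightarrow> real ^ 'a ^ 'b)"
  unfolding linear_conv_bounded_linear[symmetric]
  by (auto intro!: linearI simp: transpose_def vec_eq_iff)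

lemmas transpose_linear =
  linear_add[OF bounded_linear.linear[OF bounded_linear_transpose]]
  linear_diff[OF bounded_linear.linear[OF bounded_linear_transpose]]
  linear_neg[OF bounded_linear.linear[OF bounded_linear_transpose]]

lemma bounded_linear_mult_vec: "bounded_linear (\<lambda>A :: real ^ 'b ^ 'a. A *v x)"
  unfolding linear_conv_bounded_linear[symmetric]
  by (auto intro!: linearI simp: algebra_simps scaleR_matrix_vector_assoc)

lemma bounded_bilinear_outer: "bounded_bilinear (outer :: real ^ 'a \<Rightarrow> real ^ 'a \<Rightarrow> _)"
  unfolding bilinear_conv_bounded_bilinear[symmetric] bilinear_def
  by (auto intro!: linearI simp: outer_def vec_eq_iff algebra_simps)

lemma outer_mult_vec:
  fixes D :: "real ^ 'b ^ 'a"
  shows "outer (D *v x) (D *v x) = D ** outer x x ** transpose D"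
  by (simp add: outer_def vec_eq_iff matrix_matrix_mult_def matrix_vector_mult_def transpose_def
      sum_product sum_distrib_right sum_distrib_left mult_ac)

lemma matrix_mult_cancel:
  fixes A :: "real ^ 'b ^ 'a"
  assumes "A ** B = mat 1"
  shows "A ** (B ** C) = C"
  using assms by (simp add: matrix_mul_assoc)

lemma matrix_mult_cancel_zero:
  fixes A :: "real ^ 'b ^ 'a"
  assumes "A ** B = 0"
  shows "A ** (B ** C) = 0"
  using assms by (simp add: matrix_mul_assoc)

lemma matrix_inv_cancel:
  assumes "invertible A"
  shows "A ** matrix_inv A = mat 1" "matrix_inv A ** A = mat 1"
  using someI_ex[OF assms[unfolded invertible_def]] unfolding matrix_inv_def by auto

lemma matrix_inv_unique:
  fixes A :: "real ^ 'a ^ 'a"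
  assumes "B ** A = mat 1"
  shows "invertible A" "matrix_inv A = B"
proof -
  show *: "invertible A"
    using assms matrix_left_right_inverse unfolding invertible_def by blast
  show "matrix_inv A = B"
    using matrix_mult_cancel[OF assms, of "matrix_inv A"] matrix_inv_cancel(1)[OF *] by simp
qed

lemma invertible_iff_trivial_kernel:
  fixes A :: "real ^ 'a ^ 'a"
  shows "invertible A \<longleftrightarrow> (\<forall>x. A *v x = 0 \<longrightarrow> x = 0)"
  by (simp add: invertible_left_inverse matrix_left_invertible_ker)

lemma pos_def_imp_invertible: "pos_def A \<Longrightarrow> invertible A"
  unfolding invertible_iff_trivial_kernel pos_def_def by force

lemma transpose_matrix_inv:
  fixes A :: "real ^ 'a ^ 'a"
  assumes "invertible A" "transpose A = A"
  shows "transpose (matrix_inv A) = matrix_inv A"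
proof -
  have "transpose (matrix_inv A) ** A = transpose (A ** matrix_inv A)"
    by (simp add: matrix_transpose_mul assms(2))
  also have "\<dots> = mat 1"
    by (simp add: matrix_inv_cancel[OF assms(1)])
  finally show ?thesis
    by (rule matrix_inv_unique(2)[symmetric])
qed

text \<open>
  If \<open>X\<^sup>T X v = 0\<close> then \<open>\<parallel>X v\<parallel>\<^sup>2 = v\<^sup>T X\<^sup>T X v = 0\<close>.
\<close>

lemma invertible_gram:
  fixes X :: "real ^ 'k ^ 'n"
  assumes "inj ((*v) X)"
  shows "invertible (transpose X ** X)"
  unfolding invertible_iff_trivial_kernel
proof safe
  fix v assume "(transpose X ** X) *v v = 0"
  then have "v \<bullet> (transpose X *v (X *v v)) = 0"
    by (simp add: matrix_vector_mul_assoc del: transpose_matrix_vector)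
  then have "(X *v v) \<bullet> (X *v v) = 0"
    by (metis dot_lmul_matrix inner_commute transpose_matrix_vector)
  then have "X *v v = X *v 0" by simp
  then show "v = 0" using assms by (metis injD)
qed

section \<open>First-order expansions\<close>

text \<open>
  This states \<open>f \<epsilon> = a + \<epsilon> b + O(\<epsilon>\<^sup>2)\<close> as \<open>\<epsilon> \<down> 0\<close>. The coefficients are arguments of the relation,
  so that the rules below compute the coefficients of a compound expression.
\<close>

definition expands :: "(real \<Rightarrow> 'a :: real_normed_vector) \<Rightarrow> 'a \<Rightarrow> 'a \<Rightarrow> bool" where
  "expands f a b \<longleftrightarrow> (\<lambda>\<epsilon>. norm (f \<epsilon> - (a + \<epsilon> *\<^sub>R b))) \<in> O[at_right 0](\<lambda>\<epsilon>. \<epsilon>\<^sup>2)"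

lemma expandsI:
  assumes "\<forall>\<^sub>F \<epsilon> in at_right 0. norm (f \<epsilon> - (a + \<epsilon> *\<^sub>R b)) \<le> c * \<epsilon>\<^sup>2"
  shows "expands f a b"
  unfolding expands_def by (rule bigoI[of _ c]) (use assms in simp)

lemma expandsE:
  assumes "expands f a b"
  obtains c where "c > 0" "\<forall>\<^sub>F \<epsilon> in at_right 0. norm (f \<epsilon> - (a + \<epsilon> *\<^sub>R b)) \<le> c * \<epsilon>\<^sup>2"
  using landau_o.bigE[OF assms[unfolded expands_def]] by auto

lemma expands_const: "expands (\<lambda>_. a) a 0"
  by (rule expandsI[of _ _ _ 0]) simp

lemma expands_add:
  assumes "expands f a b" "expands g c d"
  shows "expands (\<lambda>\<epsilon>. f \<epsilon> + g \<epsilon>) (a + c) (b + d)"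
proof -
  obtain C where C: "\<forall>\<^sub>F \<epsilon> in at_right 0. norm (f \<epsilon> - (a + \<epsilon> *\<^sub>R b)) \<le> C * \<epsilon>\<^sup>2"
    using assms(1) by (rule expandsE)
  obtain D where D: "\<forall>\<^sub>F \<epsilon> in at_right 0. norm (g \<epsilon> - (c + \<epsilon> *\<^sub>R d)) \<le> D * \<epsilon>\<^sup>2"
    using assms(2) by (rule expandsE)
  show ?thesis
  proof (rule expandsI[of _ _ _ "C + D"], use C D in eventually_elim)
    case (elim \<epsilon>)
    have "f \<epsilon> + g \<epsilon> - (a + c + \<epsilon> *\<^sub>R (b + d))
        = (f \<epsilon> - (a + \<epsilon> *\<^sub>R b)) + (g \<epsilon> - (c + \<epsilon> *\<^sub>R d))"
      by (simp add: algebra_simps)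
    then have "norm (f \<epsilon> + g \<epsilon> - (a + c + \<epsilon> *\<^sub>R (b + d)))
        \<le> norm (f \<epsilon> - (a + \<epsilon> *\<^sub>R b)) + norm (g \<epsilon> - (c + \<epsilon> *\<^sub>R d))"
      by (simp only: norm_triangle_ineq)
    then show ?case
      using elim by (simp only: distrib_right)
  qed
qed

lemma expands_linear:
  assumes h: "bounded_linear h" and f: "expands f a b"
  shows "expands (\<lambda>\<epsilon>. h (f \<epsilon>)) (h a) (h b)"
proof -
  interpret bounded_linear h by fact
  obtain K where K: "K > 0" "\<And>x. norm (h x) \<le> norm x * K"
    using pos_bounded by blast
  obtain C where C: "\<forall>\<^sub>F \<epsilon> in at_right 0. norm (f \<epsilon> - (a + \<epsilon> *\<^sub>R b)) \<le> C * \<epsilon>\<^sup>2"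
    using f by (rule expandsE)
  show ?thesis
  proof (rule expandsI[of _ _ _ "C * K"], use C in eventually_elim)
    case (elim \<epsilon>)
    have "norm (h (f \<epsilon>) - (h a + \<epsilon> *\<^sub>R h b)) = norm (h (f \<epsilon> - (a + \<epsilon> *\<^sub>R b)))"
      by (simp add: diff add scaleR)
    also have "\<dots> \<le> norm (f \<epsilon> - (a + \<epsilon> *\<^sub>R b)) * K" by (rule K)
    also have "\<dots> \<le> C * \<epsilon>\<^sup>2 * K" using elim K(1) by simp
    finally show ?case by (simp add: mult_ac)
  qed
qed

lemma expands_diff:
  assumes "expands f a b" "expands g c d"
  shows "expands (\<lambda>\<epsilon>. f \<epsilon> - g \<epsilon>) (a - c) (b - d)"
  using expands_add[OF assms(1)
      expands_linear[OF bounded_linear_minus[OF bounded_linear_ident] assms(2)]]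
  by simp

text \<open>
  Write \<open>f = a + \<epsilon> b + r\<close> and \<open>g = c + \<epsilon> d + s\<close> with \<open>r, s = O(\<epsilon>\<^sup>2)\<close>. The error in the product is
  \<open>h r g + h (a + \<epsilon> b) s + \<epsilon>\<^sup>2 h b d\<close>, and \<open>g\<close> and \<open>a + \<epsilon> b\<close> stay bounded. The result is the Leibniz rule
  for the first-order coefficients.
\<close>

lemma expands_bilinear:
  assumes h: "bounded_bilinear h" and f: "expands f a b" and g: "expands g c d"
  shows "expands (\<lambda>\<epsilon>. h (f \<epsilon>) (g \<epsilon>)) (h a c) (h a d + h b c)"
proof -
  interpret bounded_bilinear h by fact
  obtain K where K: "K > 0" "\<And>x y. norm (h x y) \<le> norm x * norm y * K"
    using pos_bounded by blast
  obtain C where C: "C > 0" "\<forall>\<^sub>F \<epsilon> in at_right 0. norm (f \<epsilon> - (a + \<epsilon> *\<^sub>R b)) \<le> C * \<epsilon>\<^sup>2"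
    using f by (rule expandsE)
  obtain D where D: "D > 0" "\<forall>\<^sub>F \<epsilon> in at_right 0. norm (g \<epsilon> - (c + \<epsilon> *\<^sub>R d)) \<le> D * \<epsilon>\<^sup>2"
    using g by (rule expandsE)
  define E where "E = C * (norm c + norm d + D) * K + (norm a + norm b) * D * K
    + norm b * norm d * K"
  have small: "\<forall>\<^sub>F \<epsilon>::real in at_right 0. 0 < \<epsilon> \<and> \<epsilon> < 1"
    using eventually_at_right_real[of 0 1] by simp
  show ?thesis
  proof (rule expandsI[of _ _ _ E], use C(2) D(2) small in eventually_elim)
    case (elim \<epsilon>)
    define r where "r = f \<epsilon> - (a + \<epsilon> *\<^sub>R b)"
    define s where "s = g \<epsilon> - (c + \<epsilon> *\<^sub>R d)"
    have r: "norm r \<le> C * \<epsilon>\<^sup>2" and s: "norm s \<le> D * \<epsilon>\<^sup>2"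
      using elim by (auto simp: r_def s_def)
    have le: "\<epsilon> * x \<le> x" if "x \<ge> 0" for x
      using elim that by (simp add: mult_left_le_one_le)
    have "\<epsilon>\<^sup>2 \<le> 1" using elim by (simp add: power_le_one)
    then have "norm s \<le> D" using s D(1) by (smt (verit) mult_left_le)
    moreover have "g \<epsilon> = c + \<epsilon> *\<^sub>R d + s" by (simp add: s_def)
    ultimately have g\<epsilon>: "norm (g \<epsilon>) \<le> norm c + norm d + D"
      using norm_triangle_ineq[of "c + \<epsilon> *\<^sub>R d" s] norm_triangle_ineq[of c "\<epsilon> *\<^sub>R d"]
        le[of "norm d"] elim by simp
    have ab: "norm (a + \<epsilon> *\<^sub>R b) \<le> norm a + norm b"
      using norm_triangle_ineq[of a "\<epsilon> *\<^sub>R b"] le[of "norm b"] elim by simp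
    have eq: "h (f \<epsilon>) (g \<epsilon>) - (h a c + \<epsilon> *\<^sub>R (h a d + h b c))
        = h r (g \<epsilon>) + h (a + \<epsilon> *\<^sub>R b) s + \<epsilon>\<^sup>2 *\<^sub>R h b d"
      unfolding r_def s_def
      by (simp add: add_left add_right diff_left diff_right scaleR_left scaleR_right
          algebra_simps power2_eq_square)
    have "norm (h r (g \<epsilon>)) \<le> C * \<epsilon>\<^sup>2 * (norm c + norm d + D) * K"
      using K(1) r g\<epsilon> C(1) by (intro order_trans[OF K(2)] mult_right_mono mult_mono) auto
    moreover have "norm (h (a + \<epsilon> *\<^sub>R b) s) \<le> (norm a + norm b) * (D * \<epsilon>\<^sup>2) * K"
      using K(1) s ab by (intro order_trans[OF K(2)] mult_right_mono mult_mono) auto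
    moreover have "norm (\<epsilon>\<^sup>2 *\<^sub>R h b d) \<le> \<epsilon>\<^sup>2 * (norm b * norm d * K)"
      using K(2)[of b d] by (simp add: mult_left_mono)
    ultimately have "norm (h r (g \<epsilon>) + h (a + \<epsilon> *\<^sub>R b) s + \<epsilon>\<^sup>2 *\<^sub>R h b d)
        \<le> C * \<epsilon>\<^sup>2 * (norm c + norm d + D) * K + (norm a + norm b) * (D * \<epsilon>\<^sup>2) * K
          + \<epsilon>\<^sup>2 * (norm b * norm d * K)"
      by (intro norm_triangle_mono)
    then show ?case
      unfolding eq E_def by (simp add: algebra_simps)
  qed
qed

lemmas expands_matrix_mult = expands_bilinear[OF bounded_bilinear_matrix_mult]

text \<open>
  Let \<open>G = S\<^sup>-\<^sup>1\<close> and \<open>A = (S + \<epsilon> L)\<^sup>-\<^sup>1\<close>. The resolvent identity \<open>A = G - \<epsilon> A L G\<close> does two things. It bounds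
  \<open>\<parallel>A\<parallel>\<close> by \<open>2 \<parallel>G\<parallel>\<close> for small \<open>\<epsilon>\<close>, and applied twice it gives
  \<open>A = G - \<epsilon> G L G + \<epsilon>\<^sup>2 A L G L G\<close>. That \<open>S + \<epsilon> L\<close> is invertible follows because \<open>(S + \<epsilon> L) x = 0\<close>
  means \<open>x = - \<epsilon> G L x\<close>, which forces \<open>x = 0\<close> once \<open>\<epsilon>\<close> times the operator bound of \<open>G L\<close> is below \<open>1\<close>.
\<close>

lemma expands_matrix_inv:
  fixes S L :: "real ^ 'a ^ 'a"
  assumes "invertible S"
  shows "expands (\<lambda>\<epsilon>. matrix_inv (S + \<epsilon> *\<^sub>R L)) (matrix_inv S)
           (- (matrix_inv S ** L ** matrix_inv S))"
proof -
  define G where "G = matrix_inv S"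
  note SG = matrix_inv_cancel[OF assms, folded G_def]
  interpret mm: bounded_bilinear "(**) :: real ^ 'a ^ 'a \<Rightarrow> real ^ 'a ^ 'a \<Rightarrow> _"
    by (rule bounded_bilinear_matrix_mult)
  obtain K where K: "K > 0"
      "\<And>(A :: real ^ 'a ^ 'a) (B :: real ^ 'a ^ 'a). norm (A ** B) \<le> norm A * norm B * K"
    using mm.pos_bounded by blast
  obtain J where J: "J > 0" "\<And>x. norm ((G ** L) *v x) \<le> norm x * J"
    using bounded_linear.pos_bounded[OF matrix_vector_mul_bounded_linear[of "G ** L"]] by blast
  \<comment> \<open>\<open>\<epsilon> < 1 / c\<close> is small enough both for invertibility and for the bound \<open>\<parallel>A\<parallel> \<le> 2 \<parallel>G\<parallel>\<close>.\<close>
  define c where "c = max (2 * (norm (L ** G) * K)) J"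
  have "c > 0" using J(1) by (simp add: c_def)
  then have "\<forall>\<^sub>F \<epsilon> in at_right 0. \<epsilon> \<in> {0<..<1 / c}"
    by (intro eventually_at_right_real) simp
  then have small: "\<forall>\<^sub>F \<epsilon> in at_right 0. 0 < \<epsilon> \<and> \<epsilon> * J < 1 \<and> \<epsilon> * (2 * (norm (L ** G) * K)) < 1"
  proof eventually_elim
    case (elim \<epsilon>)
    then have "0 < \<epsilon>" "\<epsilon> * c < 1" using \<open>c > 0\<close> by (simp_all add: pos_less_divide_eq)
    moreover have "\<epsilon> * J \<le> \<epsilon> * c" "\<epsilon> * (2 * (norm (L ** G) * K)) \<le> \<epsilon> * c"
      using \<open>0 < \<epsilon>\<close> unfolding c_def by (intro mult_left_mono max.cobounded1 max.cobounded2; simp)+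
    ultimately show ?case by linarith
  qed
  show ?thesis
    unfolding G_def[symmetric]
  proof (rule expandsI[of _ _ _ "2 * norm G * norm (L ** G ** L ** G) * K"],
      use small in eventually_elim)
    case (elim \<epsilon>)
    have inv: "invertible (S + \<epsilon> *\<^sub>R L)"
      unfolding invertible_iff_trivial_kernel
    proof safe
      fix x assume "(S + \<epsilon> *\<^sub>R L) *v x = 0"
      then have "S *v x + \<epsilon> *\<^sub>R (L *v x) = 0"
        by (simp only: matrix_vector_mult_add_rdistrib scaleR_matrix_vector_assoc)
      then have "G *v (S *v x + \<epsilon> *\<^sub>R (L *v x)) = 0"
        by (simp only: matrix_vector_mult_0_right)
      then have "x + \<epsilon> *\<^sub>R ((G ** L) *v x) = 0"
        by (simp only: matrix_vector_right_distrib matrix_vector_mult_scaleR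
            matrix_vector_mul_assoc SG matrix_vector_mul_lid)
      then have "x = - (\<epsilon> *\<^sub>R ((G ** L) *v x))"
        by (simp only: eq_neg_iff_add_eq_0)
      then have "norm x = norm (\<epsilon> *\<^sub>R ((G ** L) *v x))"
        by (metis norm_minus_cancel)
      also have "\<dots> = \<epsilon> * norm ((G ** L) *v x)"
        using elim by simp
      also have "\<dots> \<le> (\<epsilon> * J) * norm x"
        using J(2)[of x] elim by (simp add: mult_left_mono mult_ac)
      finally have "(1 - \<epsilon> * J) * norm x \<le> 0"
        by (simp add: left_diff_distrib)
      then show "x = 0"
        using elim by (simp add: mult_le_0_iff)
    qed
    define A where "A = matrix_inv (S + \<epsilon> *\<^sub>R L)"
    have "A ** S + \<epsilon> *\<^sub>R (A ** L) = mat 1"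
      using matrix_inv_cancel(2)[OF inv] unfolding A_def[symmetric]
      by (simp add: mm.add_right mm.scaleR_right)
    then have "(A ** S + \<epsilon> *\<^sub>R (A ** L)) ** G = G"
      by simp
    then have "A ** S ** G + \<epsilon> *\<^sub>R (A ** L ** G) = G"
      by (simp only: mm.add_left mm.scaleR_left)
    then have res: "A = G - \<epsilon> *\<^sub>R (A ** L ** G)"
      by (simp add: matrix_mul_assoc[symmetric] SG eq_diff_eq)
    have "norm A \<le> norm G + \<epsilon> * norm (A ** (L ** G))"
      using norm_triangle_ineq4[of G "\<epsilon> *\<^sub>R (A ** L ** G)"] elim
      unfolding res[symmetric] by (simp add: matrix_mul_assoc)
    also have "\<dots> \<le> norm G + \<epsilon> * (norm A * norm (L ** G) * K)"
      using elim by (intro add_left_mono mult_left_mono K(2)) simp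
    also have "\<dots> = norm G + (\<epsilon> * (2 * (norm (L ** G) * K))) * norm A / 2" by simp
    also have "\<dots> \<le> norm G + 1 * norm A / 2"
      using elim by (intro add_left_mono divide_right_mono mult_right_mono) auto
    finally have A: "norm A \<le> 2 * norm G" by simp
    have "A - (G + \<epsilon> *\<^sub>R - (G ** L ** G)) = \<epsilon> *\<^sub>R ((G - A) ** (L ** G))"
      by (subst (1) res) (simp add: mm.diff_left scaleR_diff_right matrix_mul_assoc)
    also have "G - A = \<epsilon> *\<^sub>R (A ** L ** G)"
      by (subst (1) res) simp
    finally have "A - (G + \<epsilon> *\<^sub>R - (G ** L ** G)) = \<epsilon>\<^sup>2 *\<^sub>R (A ** (L ** G ** L ** G))"
      by (simp add: mm.scaleR_left matrix_mul_assoc power2_eq_square)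
    then have "norm (A - (G + \<epsilon> *\<^sub>R - (G ** L ** G))) = \<epsilon>\<^sup>2 * norm (A ** (L ** G ** L ** G))"
      by simp
    also have "\<dots> \<le> \<epsilon>\<^sup>2 * (norm A * norm (L ** G ** L ** G) * K)"
      by (intro mult_left_mono K) simp
    also have "\<dots> \<le> \<epsilon>\<^sup>2 * (2 * norm G * norm (L ** G ** L ** G) * K)"
      using A K(1) by (intro mult_left_mono mult_right_mono) auto
    also have "\<dots> = 2 * norm G * norm (L ** G ** L ** G) * K * \<epsilon>\<^sup>2"
      by (rule mult.commute)
    finally show ?case
      unfolding A_def .
  qed
qed

section \<open>Second moments under the linear model\<close>

text \<open>
  The cross terms are linear in \<open>u\<close> and vanish because the errors have mean zero.
\<close>

lemma (in general_linear_model) integral_outer_affine: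
  fixes D :: "real ^ 'n ^ 'k"
  shows "(\<integral>\<omega>. outer (D *v u \<omega> + b) (D *v u \<omega> + b) \<partial>M)
    = \<sigma>\<^sup>2 *\<^sub>R (D ** \<Omega> ** transpose D) + outer b b"
proof -
  interpret o: bounded_bilinear "outer :: real ^ 'k \<Rightarrow> _" by (rule bounded_bilinear_outer)
  interpret D: bounded_linear "(*v) D" by (rule matrix_vector_mul_bounded_linear)
  have quad: "bounded_linear (\<lambda>A. D ** A ** transpose D)"
    by (rule bounded_linear_compose[OF
          bounded_bilinear.bounded_linear_left[OF bounded_bilinear_matrix_mult]
          bounded_bilinear.bounded_linear_right[OF bounded_bilinear_matrix_mult]])
  have l: "bounded_linear (\<lambda>x. outer (D *v x) b)" "bounded_linear (\<lambda>x. outer b (D *v x))"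
    by (rule bounded_linear_compose[OF o.bounded_linear_left D.bounded_linear_axioms]
        bounded_linear_compose[OF o.bounded_linear_right D.bounded_linear_axioms])+
  note int = integrable_bounded_linear[OF quad error_outer_integrable]
    integrable_bounded_linear[OF l(1) error_integrable]
    integrable_bounded_linear[OF l(2) error_integrable]
  have "(\<integral>\<omega>. outer (D *v u \<omega> + b) (D *v u \<omega> + b) \<partial>M)
    = (\<integral>\<omega>. D ** outer (u \<omega>) (u \<omega>) ** transpose D + outer (D *v u \<omega>) b
          + outer b (D *v u \<omega>) + outer b b \<partial>M)"
    by (simp add: o.add_left o.add_right outer_mult_vec add_ac)
  also have "\<dots> = D ** (\<integral>\<omega>. outer (u \<omega>) (u \<omega>) \<partial>M) ** transpose D
      + outer (D *v expectation u) b + outer b (D *v expectation u) + outer b b"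
    using int by (simp add: integral_bounded_linear[OF quad error_outer_integrable]
        integral_bounded_linear[OF l(1) error_integrable]
        integral_bounded_linear[OF l(2) error_integrable] prob_space)
  finally show ?thesis
    by (simp add: error_mean error_dispersion D.zero o.zero_left o.zero_right
        matrix_mult_bilinear)
qed

text \<open>
  A bias that vanishes at \<open>\<epsilon> = 0\<close> enters through its outer square, which is \<open>O(\<epsilon>\<^sup>2)\<close>.
\<close>

lemma (in general_linear_model) expands_second_moment:
  fixes D :: "real \<Rightarrow> real ^ 'n ^ 'k"
  assumes D: "expands D a b" and bias: "expands bias 0 v"
  shows "expands (\<lambda>\<epsilon>. \<integral>\<omega>. outer (D \<epsilon> *v u \<omega> + bias \<epsilon>) (D \<epsilon> *v u \<omega> + bias \<epsilon>) \<partial>M)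
    (\<sigma>\<^sup>2 *\<^sub>R (a ** \<Omega> ** transpose a))
    (\<sigma>\<^sup>2 *\<^sub>R (a ** \<Omega> ** transpose b + b ** \<Omega> ** transpose a))"
proof -
  have disp: "expands (\<lambda>\<epsilon>. D \<epsilon> ** \<Omega> ** transpose (D \<epsilon>)) (a ** \<Omega> ** transpose a)
      (a ** \<Omega> ** transpose b + b ** \<Omega> ** transpose a)"
    using expands_matrix_mult[OF expands_matrix_mult[OF D expands_const]
        expands_linear[OF bounded_linear_transpose D], of \<Omega>]
    by simp
  have "expands (\<lambda>\<epsilon>. outer (bias \<epsilon>) (bias \<epsilon>)) 0 0"
    using expands_bilinear[OF bounded_bilinear_outer bias bias]
    by (simp add: bounded_bilinear.zero_left[OF bounded_bilinear_outer]
        bounded_bilinear.zero_right[OF bounded_bilinear_outer])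
  from expands_add[OF expands_linear[OF bounded_linear_scaleR_right disp] this] show ?thesis
    by (simp add: integral_outer_affine)
qed

section \<open>The best linear unbiased estimator for a decomposed dispersion matrix\<close>

locale decomposed_dispersion =
  fixes X :: "real ^ 'k ^ 'n" and Z :: "real ^ 'm ^ 'n"
    and \<Gamma> :: "real ^ 'k ^ 'k" and \<Delta> :: "real ^ 'm ^ 'm" and \<Xi> :: "real ^ 'm ^ 'k"
    and \<Omega> :: "real ^ 'n ^ 'n"
  assumes inj_X: "inj ((*v) X)" and inj_Z: "inj ((*v) Z)"
    and orthogonal: "transpose X ** Z = 0"
    and symmetric_Gamma: "transpose \<Gamma> = \<Gamma>" and symmetric_Delta: "transpose \<Delta> = \<Delta>"
    and invertible_Delta: "invertible \<Delta>" and invertible_Omega: "invertible \<Omega>"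
    and decomposition: "\<Omega> = X ** \<Gamma> ** transpose X + Z ** \<Delta> ** transpose Z
           + X ** \<Xi> ** transpose Z + Z ** transpose \<Xi> ** transpose X"
begin

definition G :: "real ^ 'k ^ 'k" where "G = matrix_inv (transpose X ** X)"

definition H :: "real ^ 'm ^ 'm" where "H = matrix_inv (transpose Z ** Z)"

definition P :: "real ^ 'k ^ 'k" where "P = \<Xi> ** matrix_inv \<Delta> ** transpose \<Xi>"

text \<open>
  Let \<open>y\<close> have dispersion matrix \<open>\<sigma>\<^sup>2 \<Omega>\<close>. The residual coordinates \<open>H Z\<^sup>T y\<close> carry information on the error of the least squares estimator
  \<open>G X\<^sup>T y\<close>: their dispersion matrix is \<open>\<sigma>\<^sup>2 \<Delta>\<close>, and the covariance of \<open>G X\<^sup>T y\<close> with them is \<open>\<sigma>\<^sup>2 \<Xi>\<close>.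
  The matrix below is the linear regression of \<open>G X\<^sup>T y\<close> on them, and subtracting it leaves the best
  linear unbiased estimator.
\<close>

definition correction :: "real ^ 'n ^ 'k" where
  "correction = \<Xi> ** matrix_inv \<Delta> ** H ** transpose Z"

definition blue :: "real ^ 'n ^ 'k" where
  "blue = G ** transpose X - correction"

lemma orthogonal': "transpose Z ** X = 0"
  using arg_cong[OF orthogonal, of transpose]
  by (simp add: matrix_transpose_mul linear_0[OF bounded_linear.linear[OF bounded_linear_transpose]])

lemma transposes: "transpose G = G" "transpose H = H" "transpose P = P"
    "transpose (matrix_inv \<Delta>) = matrix_inv \<Delta>"
  unfolding G_def H_def P_def
  by (simp_all add: transpose_matrix_inv invertible_gram inj_X inj_Z invertible_Delta
      symmetric_Delta matrix_transpose_mul matrix_mul_assoc)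

lemmas inverse_pairs =
  matrix_inv_cancel(1)[OF invertible_gram[OF inj_X], folded G_def]
  matrix_inv_cancel(2)[OF invertible_gram[OF inj_X], folded G_def]
  matrix_inv_cancel(1)[OF invertible_gram[OF inj_Z], folded H_def]
  matrix_inv_cancel(2)[OF invertible_gram[OF inj_Z], folded H_def]
  matrix_inv_cancel[OF invertible_Delta]
  matrix_inv_cancel[OF invertible_Omega]

text \<open>
  With all products nested to the right, a product of two adjacent factors can occur alone or in front
  of a further factor, so each cancellation law is given in both forms. Rewriting with these laws
  multiplies out the expressions below.
\<close>

lemmas cancel_rules =
  orthogonal orthogonal' matrix_mult_cancel_zero[OF orthogonal] matrix_mult_cancel_zero[OF orthogonal']
  inverse_pairs[unfolded matrix_mul_assoc[symmetric]]
  inverse_pairs[THEN matrix_mult_cancel, unfolded matrix_mul_assoc[symmetric]]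

lemmas right_nested = matrix_mul_assoc[symmetric] matrix_mult_bilinear cancel_rules

lemma blue_unbiased: "blue ** X = mat 1"
  by (simp add: blue_def correction_def right_nested)

text \<open>
  Multiplying \<open>G X\<^sup>T\<close> by \<open>\<Omega>\<close> gives \<open>\<Gamma> X\<^sup>T + \<Xi> Z\<^sup>T\<close>, and the correction removes exactly the \<open>Z\<close> part at
  the price of \<open>P X\<^sup>T\<close>. A product with \<open>\<Omega>\<close> of the form \<open>V X\<^sup>T\<close> is what makes an unbiased estimator equal
  to \<open>V X\<^sup>T \<Omega>\<^sup>-\<^sup>1\<close> and hence to the generalized least squares estimator.
\<close>

lemma blue_Omega: "blue ** \<Omega> = (\<Gamma> - P) ** transpose X"
  by (simp add: blue_def correction_def P_def decomposition right_nested)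

lemma correction_Omega: "correction ** \<Omega> = \<Xi> ** transpose Z + P ** transpose X"
  by (simp add: correction_def P_def decomposition right_nested)

lemma blue_gls: "(\<Gamma> - P) ** transpose X ** matrix_inv \<Omega> = blue"
  by (simp add: blue_Omega[symmetric] right_nested del: matrix_mult_bilinear)

text \<open>
  Since \<open>(\<Gamma> - P) X\<^sup>T \<Omega>\<^sup>-\<^sup>1 X = blue X = I\<close> and the matrices are square, this left inverse is the inverse.
\<close>

lemma gls_information:
  "invertible (transpose X ** matrix_inv \<Omega> ** X)"
  "matrix_inv (transpose X ** matrix_inv \<Omega> ** X) = \<Gamma> - P"
  using matrix_inv_unique[of "\<Gamma> - P" "transpose X ** matrix_inv \<Omega> ** X"]
  by (simp_all add: matrix_mul_assoc blue_gls blue_unbiased)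

lemma expands_ols_ridge:
  "expands (\<lambda>\<epsilon>. matrix_inv (transpose X ** X + \<epsilon> *\<^sub>R L) ** transpose X)
     (G ** transpose X) (- (G ** L ** G ** transpose X))"
  using expands_matrix_mult[OF expands_matrix_inv[OF invertible_gram[OF inj_X]] expands_const]
  by (simp add: G_def[symmetric] matrix_mult_bilinear)

lemma expands_gls_ridge:
  "expands (\<lambda>\<epsilon>. matrix_inv (transpose X ** matrix_inv \<Omega> ** X + \<epsilon> *\<^sub>R L)
       ** transpose X ** matrix_inv \<Omega>)
     blue (- ((\<Gamma> - P) ** L ** blue))"
  using expands_matrix_mult[OF expands_matrix_inv[OF gls_information(1)] expands_const,
      of L "transpose X ** matrix_inv \<Omega>"]
  by (simp add: gls_information(2) bounded_bilinear.minus_left[OF bounded_bilinear_matrix_mult]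
      matrix_mul_assoc blue_gls)
     (simp add: matrix_mul_assoc[symmetric] blue_gls[unfolded matrix_mul_assoc[symmetric]])

text \<open>
  The matrix \<open>b\<close> is the first-order coefficient of the difference of the two estimators, whose value at
  \<open>\<epsilon> = 0\<close> is \<open>correction\<close>. The terms in \<open>L1\<close> cancel because
  \<open>correction \<Omega> blue\<^sup>T = 0\<close>: the best linear unbiased estimator is uncorrelated with its difference
  from any other unbiased linear estimator.
\<close>

lemma difference_dispersion:
  fixes L1 L2 :: "real ^ 'k ^ 'k"
  assumes "transpose L1 = L1" "transpose L2 = L2"
  defines "b \<equiv> - (G ** L2 ** G ** transpose X) - - ((\<Gamma> - P) ** L1 ** blue)"
  shows "correction ** \<Omega> ** transpose correction = P"
    and "correction ** \<Omega> ** transpose b = - (P ** L2 ** G)"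
    and "b ** \<Omega> ** transpose correction = - (G ** L2 ** P)"
proof -
  show "correction ** \<Omega> ** transpose correction = P"
    unfolding correction_Omega
    by (simp add: correction_def P_def matrix_transpose_mul transposes right_nested)
  show *: "correction ** \<Omega> ** transpose b = - (P ** L2 ** G)"
    unfolding correction_Omega b_def
    by (simp add: matrix_transpose_mul transpose_linear transposes assms blue_def correction_def
        right_nested P_def)
  have Om: "transpose \<Omega> = \<Omega>"
    by (simp add: decomposition matrix_transpose_mul transpose_linear symmetric_Gamma
        symmetric_Delta matrix_mul_assoc add_ac)
  have "b ** \<Omega> ** transpose correction = transpose (correction ** \<Omega> ** transpose b)"
    by (simp add: matrix_transpose_mul Om matrix_mul_assoc)
  then show "b ** \<Omega> ** transpose correction = - (G ** L2 ** P)"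
    unfolding * by (simp add: matrix_transpose_mul transpose_linear transposes assms matrix_mul_assoc)
qed

lemma ols_dispersion:
  fixes L :: "real ^ 'k ^ 'k"
  assumes "transpose L = L"
  defines "a \<equiv> G ** transpose X" and "b \<equiv> - (G ** L ** G ** transpose X)"
  shows "a ** \<Omega> ** transpose a = \<Gamma>"
    and "a ** \<Omega> ** transpose b = - (\<Gamma> ** L ** G)"
    and "b ** \<Omega> ** transpose a = - (G ** L ** \<Gamma>)"
  unfolding a_def b_def decomposition
  by (simp_all add: matrix_transpose_mul transpose_linear transposes assms right_nested)

lemma gls_dispersion:
  fixes L :: "real ^ 'k ^ 'k"
  assumes "transpose L = L"
  defines "b \<equiv> - ((\<Gamma> - P) ** L ** blue)"
  shows "blue ** \<Omega> ** transpose blue = \<Gamma> - P"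
    and "blue ** \<Omega> ** transpose b = - ((\<Gamma> - P) ** L ** (\<Gamma> - P))"
    and "b ** \<Omega> ** transpose blue = - ((\<Gamma> - P) ** L ** (\<Gamma> - P))"
proof -
  have "transpose (blue ** X) = mat 1"
    by (simp add: blue_unbiased)
  then have tb: "transpose X ** transpose blue = mat 1"
    by (simp add: matrix_transpose_mul)
  have V: "transpose (\<Gamma> - P) = \<Gamma> - P"
    by (simp add: transpose_linear symmetric_Gamma transposes)
  show *: "blue ** \<Omega> ** transpose blue = \<Gamma> - P"
    unfolding blue_Omega by (simp add: matrix_mul_assoc[symmetric] tb)
  have "transpose b = - (transpose blue ** (L ** (\<Gamma> - P)))"
    unfolding b_def transpose_linear(3) matrix_transpose_mul V assms(1) ..
  then show "blue ** \<Omega> ** transpose b = - ((\<Gamma> - P) ** L ** (\<Gamma> - P))"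
    by (simp only: matrix_mult_bilinear(6) matrix_mul_assoc *)
  show "b ** \<Omega> ** transpose blue = - ((\<Gamma> - P) ** L ** (\<Gamma> - P))"
    unfolding b_def matrix_mult_bilinear(5)
    by (simp only: matrix_mul_assoc[symmetric] *[unfolded matrix_mul_assoc[symmetric]])
qed

end

section \<open>Comparison of the two ridge estimators\<close>

lemma ridge_ols:
  fixes X :: "real ^ 'k ^ 'n"
  shows "ridge X (mat 1) K = (*v) (matrix_inv (transpose X ** X + K) ** transpose X)"
proof -
  have "matrix_inv (mat 1) = (mat 1 :: real ^ 'n ^ 'n)"
    by (rule matrix_inv_unique(2)) simp
  then show ?thesis by (simp add: ridge_def fun_eq_iff)
qed

theorem theorem6:
  fixes M :: "'w measure"
    and X :: "real ^ 'k ^ 'n"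
    and Z :: "real ^ 'm ^ 'n"
    and \<beta> :: "real ^ 'k"
    and \<sigma> :: real
    and u y :: "'w \<Rightarrow> real ^ 'n"
    and \<Omega> :: "real ^ 'n ^ 'n"
    and \<Gamma> L1 L2 :: "real ^ 'k ^ 'k"
    and \<Delta> :: "real ^ 'm ^ 'm"
    and \<Xi> :: "real ^ 'm ^ 'k"
    and N :: "real ^ 'k ^ 'k \<Rightarrow> real"
  assumes "CARD('n) > CARD('k)"
    and "CARD('m) = CARD('n) - CARD('k)"
    and "rank X = CARD('k)"
    and "transpose X ** Z = 0"
    and "rank Z = CARD('n) - CARD('k)"
    and "general_linear_model M X \<beta> \<sigma> \<Omega> u y"
    and "pos_semidef L1"
    and "pos_semidef L2"
    and "pos_def \<Omega>"
    and "pos_def \<Gamma>"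
    and "pos_def \<Delta>"
    and "\<Omega> = X ** \<Gamma> ** transpose X + Z ** \<Delta> ** transpose Z
           + X ** \<Xi> ** transpose Z + Z ** transpose \<Xi> ** transpose X"
    and "matrix_norm N"
  defines "P \<equiv> \<Xi> ** matrix_inv \<Delta> ** transpose \<Xi>"
    and "G \<equiv> matrix_inv (transpose X ** X)"
  defines "F \<equiv> at 0 within {\<epsilon>::real. 0 < \<epsilon> \<and> \<epsilon> * max (N ((\<Gamma> - P) ** L1)) (N (G ** L2)) < 1}"
  shows "(\<lambda>\<epsilon>. norm (d1 M X y \<Omega> (\<epsilon> *\<^sub>R L1) (\<epsilon> *\<^sub>R L2)
               - (\<sigma>\<^sup>2 *\<^sub>R P - \<epsilon> *\<^sub>R \<sigma>\<^sup>2 *\<^sub>R (P ** L2 ** G + G ** L2 ** P))))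
           \<in> O[F](\<lambda>\<epsilon>. \<epsilon>\<^sup>2)
       \<and> (\<lambda>\<epsilon>. norm (d2 M X \<beta> y \<Omega> (\<epsilon> *\<^sub>R L1) (\<epsilon> *\<^sub>R L2)
               - (\<sigma>\<^sup>2 *\<^sub>R P - \<epsilon> *\<^sub>R \<sigma>\<^sup>2 *\<^sub>R (G ** L2 ** \<Gamma> + \<Gamma> ** L2 ** G
                     - 2 *\<^sub>R ((\<Gamma> - P) ** L1 ** (\<Gamma> - P))))))
           \<in> O[F](\<lambda>\<epsilon>. \<epsilon>\<^sup>2)"
proof -
  interpret general_linear_model M X \<beta> \<sigma> \<Omega> u y by fact
  have L: "transpose L1 = L1" "transpose L2 = L2"
    using assms(7,8) by (auto simp: pos_semidef_def symmetric_matrix_def)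
  interpret dd: decomposed_dispersion X Z \<Gamma> \<Delta> \<Xi> \<Omega>
  proof
    show "inj ((*v) X)" "inj ((*v) Z)"
      using assms(2,3,5) by (simp_all add: full_rank_injective[symmetric])
    show "transpose \<Gamma> = \<Gamma>" "transpose \<Delta> = \<Delta>"
      using assms(10,11) by (auto simp: pos_def_def symmetric_matrix_def)
  qed (use assms pos_def_imp_invertible in auto)
  have P: "P = dd.P" and G: "G = dd.G"
    by (simp_all add: P_def G_def dd.P_def dd.G_def)
  have F: "F = at_right 0"
    unfolding F_def by (rule at_within_admissible)
  define A where "A \<epsilon> = matrix_inv (transpose X ** X + \<epsilon> *\<^sub>R L2) ** transpose X" for \<epsilon>
  define B where "B \<epsilon> = matrix_inv (transpose X ** matrix_inv \<Omega> ** X + \<epsilon> *\<^sub>R L1)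
    ** transpose X ** matrix_inv \<Omega>" for \<epsilon>
  have ridge: "ridge X (mat 1) (\<epsilon> *\<^sub>R L2) v = A \<epsilon> *v v" "ridge X \<Omega> (\<epsilon> *\<^sub>R L1) v = B \<epsilon> *v v" for \<epsilon> v
    by (simp_all add: ridge_ols A_def) (simp add: ridge_def B_def)
  have A: "expands A (G ** transpose X) (- (G ** L2 ** G ** transpose X))"
    using dd.expands_ols_ridge unfolding A_def G .
  have B: "expands B dd.blue (- ((\<Gamma> - P) ** L1 ** dd.blue))"
    using dd.expands_gls_ridge unfolding B_def P .
  have AX: "G ** transpose X ** X = mat 1"
    using dd.inverse_pairs(2) by (simp add: G matrix_mul_assoc)
  note AB = expands_diff[OF A B]
  \<comment> \<open>For an estimator matrix with first-order expansion \<open>a + \<epsilon> b\<close> and \<open>a ** X = c\<close>, the deviation of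
    \<open>D \<epsilon> ** X\<close> from \<open>c\<close> starts at order \<open>\<epsilon>\<close>. The values of \<open>c\<close> used are \<open>0\<close> for the difference of the
    estimators and \<open>I\<close> for each of them.\<close>
  have bias: "\<exists>v. expands (\<lambda>\<epsilon>. (D \<epsilon> ** X - c) *v \<beta>) 0 v"
    if "expands D a b" "a ** X = c" for D a b c
  proof -
    have "expands (\<lambda>\<epsilon>. D \<epsilon> ** X - c) (c - c) (a ** 0 + b ** X - 0)"
      using expands_diff[OF expands_matrix_mult[OF that(1) expands_const[of X]] expands_const[of c]]
      unfolding that(2) .
    from expands_linear[OF bounded_linear_mult_vec this, of \<beta>] show ?thesis
      by auto
  qed
  obtain v where v: "expands (\<lambda>\<epsilon>. ((A \<epsilon> - B \<epsilon>) ** X - 0) *v \<beta>) 0 v"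
    using bias[OF AB, of 0] by (auto simp: matrix_mult_bilinear AX dd.blue_unbiased)
  obtain vA where vA: "expands (\<lambda>\<epsilon>. (A \<epsilon> ** X - mat 1) *v \<beta>) 0 vA"
    using bias[OF A AX] by auto
  obtain vB where vB: "expands (\<lambda>\<epsilon>. (B \<epsilon> ** X - mat 1) *v \<beta>) 0 vB"
    using bias[OF B dd.blue_unbiased] by auto
  have d1: "d1 M X y \<Omega> (\<epsilon> *\<^sub>R L1) (\<epsilon> *\<^sub>R L2) =
      (\<integral>\<omega>. outer ((A \<epsilon> - B \<epsilon>) *v u \<omega> + ((A \<epsilon> - B \<epsilon>) ** X - 0) *v \<beta>)
             ((A \<epsilon> - B \<epsilon>) *v u \<omega> + ((A \<epsilon> - B \<epsilon>) ** X - 0) *v \<beta>) \<partial>M)" for \<epsilon>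
    unfolding d1_def ridge
    by (simp add: model matrix_mult_bilinear matrix_vector_mult_diff_rdistrib
        matrix_vector_right_distrib matrix_vector_mul_assoc add_diff_add add.commute)
  have mmse: "mmse M \<beta> (\<lambda>\<omega>. D *v y \<omega>) =
      (\<integral>\<omega>. outer (D *v u \<omega> + (D ** X - mat 1) *v \<beta>) (D *v u \<omega> + (D ** X - mat 1) *v \<beta>) \<partial>M)" for D
  proof -
    have "D *v y \<omega> - \<beta> = D *v u \<omega> + (D ** X - mat 1) *v \<beta>" for \<omega>
      by (simp add: model matrix_vector_mult_diff_rdistrib matrix_vector_right_distrib
          matrix_vector_mul_assoc)
    then show ?thesis
      unfolding mmse_def by simp
  qed
  have cor: "G ** transpose X - dd.blue = dd.correction"
    by (simp add: dd.blue_def G)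
  have E1: "expands (\<lambda>\<epsilon>. d1 M X y \<Omega> (\<epsilon> *\<^sub>R L1) (\<epsilon> *\<^sub>R L2))
      (\<sigma>\<^sup>2 *\<^sub>R P) (\<sigma>\<^sup>2 *\<^sub>R (- (P ** L2 ** G) + - (G ** L2 ** P)))"
    unfolding d1
    using expands_second_moment[OF AB v]
    unfolding cor unfolding P G dd.difference_dispersion[OF L] .
  have E2: "expands (\<lambda>\<epsilon>. d2 M X \<beta> y \<Omega> (\<epsilon> *\<^sub>R L1) (\<epsilon> *\<^sub>R L2))
      (\<sigma>\<^sup>2 *\<^sub>R \<Gamma> - \<sigma>\<^sup>2 *\<^sub>R (\<Gamma> - P))
      (\<sigma>\<^sup>2 *\<^sub>R (- (\<Gamma> ** L2 ** G) + - (G ** L2 ** \<Gamma>))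
       - \<sigma>\<^sup>2 *\<^sub>R (- ((\<Gamma> - P) ** L1 ** (\<Gamma> - P)) + - ((\<Gamma> - P) ** L1 ** (\<Gamma> - P))))"
    unfolding d2_def ridge mmse
    using expands_diff[OF expands_second_moment[OF A vA] expands_second_moment[OF B vB]]
    unfolding P G dd.ols_dispersion[OF L(2)] dd.gls_dispersion[OF L(1)] .
  show ?thesis
    using E1 E2 unfolding expands_def F
    by (simp add: algebra_simps scaleR_2)
qed

end
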